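(* Let $M,N\ge 1$ and $D\ge 0$ be integers with $D<M$, and consider the block-wise time-domain ODDM input-output relation $$r_{n,m}=\sum_{d=0}^{\min(m,D)} h_{n,m}^d\, s_{n,m-d}+z_{n,m},\qquad 0\le n\le N-1,\ 0\le m\le M-1,$$ with deterministic channel coefficients $h_{n,m}^d\in\mathbb{C}$, random transmitted samples $s_{n,m}$ of power $P_t=\mathbb{E}[|s_{n,m}|^2]$, and noise samples $z_{n,m}$ of variance $\sigma_w^2>0$, as described in the context. Let $\epsilon_0,\dots,\epsilon_{M-1}\in\{0,1\}$ be fixed, where $\epsilon_k=1$ means that the $k$-th multi-carrier symbol index has already been estimated, and assume perfect interference cancellation (the estimates satisfy $\overline{s}_{n,k}=s_{n,k}$ for all $n$ whenever $\epsilon_k=1$). Fix $0\le n\le N-1$ and $0\le m\le M-D-1$, and put $m'=\max(m-D,0)$ and $D'=\min(m,D)$. Let $\mathbf{H}_{n,m}$ be the sub-channel matrix, and let $$\boldsymbol{\varphi}_{n,m}=\mathbf{H}_{n,m}[:,D']\,s_{n,m},\qquad \hat{\mathbf{z}}_{n,m}=\sum_{j=0,\,j\ne D'}^{D'+D}\mathbf{H}_{n,m}[:,j]\,(1-\epsilon_{m'+j})\,s_{n,m'+j}+\mathbf{z}_{n,m}$$ be the signal component and the noise-plus-interference component of the received vector after interference cancellation, all as defined in the context. Then the SINR $\Pi_{n,m}$ of the $(n,m)$-th symbol, defined by $\Pi_{n,m}=\mathbb{E}[\boldsymbol{\varphi}_{n,m}^H\boldsymbol{\varphi}_{n,m}]\,/\,\mathbb{E}[\hat{\mathbf{z}}_{n,m}^H\hat{\mathbf{z}}_{n,m}]$,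 equals $$\Pi_{n,m}=\frac{P_t\,\|\mathbf{H}_{n,m}[:,D']\|^2}{\sum_{j=0,\,j\neq D'}^{D'+D}(1-\epsilon_{m'+j})\,P_t\,\|\mathbf{H}_{n,m}[:,j]\|^2+(D+1)\,\sigma_w^2}.$$
   Context: Transmitted samples. The delay-Doppler data symbols $X[m,k]$ ($0\le m\le M-1$, $0\le k\le N-1$) are independent, zero-mean complex random variables with finite second moments. The time-domain samples are $s_{n,m}=\frac{1}{\sqrt N}\sum_{k=0}^{N-1}X[m,k]e^{\mathrm{j}2\pi kn/N}$ (block index $n$, multi-carrier symbol index $m$), where $\mathrm{j}=\sqrt{-1}$. The transmit power $P_t=\mathbb{E}[|s_{n,m}|^2]$ is the same for all $n,m$. The transmit SNR is $P_t/\sigma_w^2$. Noise. The $z_{n,m}$ are zero-mean complex random variables with $\mathbb{E}[|z_{n,m}|^2]=\sigma_w^2$, uncorrelated with the transmitted samples (i.e. $\mathbb{E}[s_{n,k}\,z_{n,l}^*]=0$ for all $n,k,l$). Channel. The coefficients are deterministic complex numbers $$h_{n,m}^d=\sum_{p=1}^P\rho_p\,g((d-l_p)T_s)\,e^{\mathrm{j}\frac{2\pi}{MN}k_p(m-l_p)}\,e^{\mathrm{j}2\pi\frac{nk_p}{N}},\qquad 0\le d\le D,$$ where $P$ is the number of paths, $\rho_p\in\mathbb{C}$ are path gains, $l_p,k_p\in\mathbb{R}$ are normalized (not necessarily integer) delays and Doppler shifts, $T_s>0$ is the sampling period, and $g$ is the convolution of the transmit pulse $a(\tau)$ with $a^*(-\tau)$.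 Sub-channel. For $0\le m\le M-D-1$, $m'=\max(m-D,0)$, $D'=\min(m,D)$ (so $m'+D'=m$), set $\overline{\mathbf{r}}_{n,m}=[r_{n,m},\dots,r_{n,m+D}]^T$ and $\mathbf{z}_{n,m}=[z_{n,m},\dots,z_{n,m+D}]^T$. The sub-channel $\mathbf{H}_{n,m}\in\mathbb{C}^{(D+1)\times(D'+D+1)}$ is the matrix for which $\overline{\mathbf{r}}_{n,m}=\sum_{j=0}^{D'+D}\mathbf{H}_{n,m}[:,j]\,s_{n,m'+j}+\mathbf{z}_{n,m}$. Explicitly, with rows $0\le i\le D$ and columns $0\le j\le D'+D$ indexed from $0$, its $(i,j)$ entry is $h_{n,m+i}^{D'+i-j}$ if $0\le D'+i-j\le D$, and $0$ otherwise. $\mathbf{H}_{n,m}[:,j]$ denotes its $j$-th column, so $\mathbf{H}_{n,m}[:,D']=[h_{n,m}^0,h_{n,m+1}^1,\dots,h_{n,m+D}^D]^T$ is the column multiplying $s_{n,m}$. Interference cancellation. The already estimated symbols are subtracted: $\widetilde{\mathbf{r}}_{n,m}=\overline{\mathbf{r}}_{n,m}-\sum_{j\ne D'}\epsilon_{m'+j}\mathbf{H}_{n,m}[:,j]\,\overline{s}_{n,m'+j}$, where $\overline{s}_{n,k}$ is the estimate of $s_{n,k}$. Under perfect cancellation $\widetilde{\mathbf{r}}_{n,m}=\boldsymbol{\varphi}_{n,m}+\hat{\mathbf{z}}_{n,m}$. $(\cdot)^H$ is the conjugate transpose and $\|\cdot\|$ is the Euclidean norm. *)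

theory Defs
  imports "HOL-Probability.Probability" "Jordan_Normal_Form.Matrix"
begin

text \<open>
  Column vectors of length \<open>D + 1\<close> and the sub-channel matrices have dimensions that depend on
  variables of the statement, so they are the carrier-based vectors and matrices of
  \<^theory>\<open>Jordan_Normal_Form.Matrix\<close>; the index notation below is the one for these vectors.
\<close>

unbundle no vec_syntax

definition convolution_fun :: "(real \<Rightarrow> complex) \<Rightarrow> (real \<Rightarrow> complex) \<Rightarrow> real \<Rightarrow> complex" where
  "convolution_fun f1 f2 t = (\<integral>u. f1 u * f2 (t - u) \<partial>lborel)"

definition matched_pulse :: "(real \<Rightarrow> complex) \<Rightarrow> real \<Rightarrow> complex" where
  "matched_pulse a = convolution_fun a (\<lambda>\<tau>. cnj (a (- \<tau>)))"

text \<open>Throughout, \<open>n\<close> is the block index and \<open>m\<close> the multi-carrier symbol index.\<close>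

definition time_sample ::
  "nat \<Rightarrow> (nat \<Rightarrow> nat \<Rightarrow> 'w \<Rightarrow> complex) \<Rightarrow> nat \<Rightarrow> nat \<Rightarrow> 'w \<Rightarrow> complex" where
  "time_sample N X n m \<omega> =
     1 / complex_of_real (sqrt (real N)) *
     (\<Sum>k<N. X m k \<omega> * exp (\<i> * complex_of_real (2 * pi * real k * real n / real N)))"

definition channel_coeff ::
  "nat \<Rightarrow> nat \<Rightarrow> nat \<Rightarrow> (nat \<Rightarrow> complex) \<Rightarrow> (nat \<Rightarrow> real) \<Rightarrow> (nat \<Rightarrow> real) \<Rightarrow> (real \<Rightarrow> complex) \<Rightarrow> real
     \<Rightarrow> nat \<Rightarrow> nat \<Rightarrow> nat \<Rightarrow> complex" where
  "channel_coeff M N P \<rho> l \<kappa> g Ts n m d =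
     (\<Sum>p = 1..P. \<rho> p * g ((real d - l p) * Ts)
        * exp (\<i> * complex_of_real (2 * pi / (real M * real N) * \<kappa> p * (real m - l p)))
        * exp (\<i> * complex_of_real (2 * pi * (real n * \<kappa> p / real N))))"

definition received_sample ::
  "nat \<Rightarrow> (nat \<Rightarrow> nat \<Rightarrow> nat \<Rightarrow> complex) \<Rightarrow> (nat \<Rightarrow> nat \<Rightarrow> 'w \<Rightarrow> complex)
     \<Rightarrow> (nat \<Rightarrow> nat \<Rightarrow> 'w \<Rightarrow> complex) \<Rightarrow> nat \<Rightarrow> nat \<Rightarrow> 'w \<Rightarrow> complex" where
  "received_sample D h s z n m \<omega> = (\<Sum>d\<le>min m D. h n m d * s n (m - d) \<omega>) + z n m \<omega>"

definition sample_vec ::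
  "nat \<Rightarrow> (nat \<Rightarrow> nat \<Rightarrow> 'w \<Rightarrow> complex) \<Rightarrow> nat \<Rightarrow> nat \<Rightarrow> 'w \<Rightarrow> complex vec" where
  "sample_vec D f n m \<omega> = vec (D + 1) (\<lambda>i. f n (m + i) \<omega>)"

text \<open>
  In what follows \<open>m' = max (m - D) 0\<close> is the truncated natural-number difference \<open>m - D\<close>, and
  \<open>D' = min m D\<close>.  In the matrix, \<open>j \<le> D' + i\<close> says that the integer \<open>D' + i - j\<close> is nonnegative.
\<close>

definition sub_channel ::
  "nat \<Rightarrow> (nat \<Rightarrow> nat \<Rightarrow> nat \<Rightarrow> complex) \<Rightarrow> nat \<Rightarrow> nat \<Rightarrow> complex mat" where
  "sub_channel D h n m = (let D' = min m D in
     mat (D + 1) (D' + D + 1)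
       (\<lambda>(i, j). if j \<le> D' + i \<and> D' + i - j \<le> D then h n (m + i) (D' + i - j) else 0))"

definition cancelled_vec ::
  "nat \<Rightarrow> (nat \<Rightarrow> nat \<Rightarrow> nat \<Rightarrow> complex) \<Rightarrow> (nat \<Rightarrow> real) \<Rightarrow> (nat \<Rightarrow> nat \<Rightarrow> 'w \<Rightarrow> complex)
     \<Rightarrow> (nat \<Rightarrow> nat \<Rightarrow> 'w \<Rightarrow> complex) \<Rightarrow> nat \<Rightarrow> nat \<Rightarrow> 'w \<Rightarrow> complex vec" where
  "cancelled_vec D h \<epsilon> r sbar n m \<omega> = (let m' = m - D; D' = min m D; H = sub_channel D h n m in
     sample_vec D r n m \<omega>
     - finsum_vec TYPE(complex) (D + 1)
         (\<lambda>j. (complex_of_real (\<epsilon> (m' + j)) * sbar n (m' + j) \<omega>) \<cdot>\<^sub>v col H j)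
         ({0..D' + D} - {D'}))"

definition signal_component ::
  "nat \<Rightarrow> (nat \<Rightarrow> nat \<Rightarrow> nat \<Rightarrow> complex) \<Rightarrow> (nat \<Rightarrow> nat \<Rightarrow> 'w \<Rightarrow> complex)
     \<Rightarrow> nat \<Rightarrow> nat \<Rightarrow> 'w \<Rightarrow> complex vec" where
  "signal_component D h s n m \<omega> = s n m \<omega> \<cdot>\<^sub>v col (sub_channel D h n m) (min m D)"

definition noise_interference_component ::
  "nat \<Rightarrow> (nat \<Rightarrow> nat \<Rightarrow> nat \<Rightarrow> complex) \<Rightarrow> (nat \<Rightarrow> real) \<Rightarrow> (nat \<Rightarrow> nat \<Rightarrow> 'w \<Rightarrow> complex)
     \<Rightarrow> (nat \<Rightarrow> nat \<Rightarrow> 'w \<Rightarrow> complex) \<Rightarrow> nat \<Rightarrow> nat \<Rightarrow> 'w \<Rightarrow> complex vec" where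
  "noise_interference_component D h \<epsilon> s z n m \<omega> =
     (let m' = m - D; D' = min m D; H = sub_channel D h n m in
      finsum_vec TYPE(complex) (D + 1)
        (\<lambda>j. (complex_of_real (1 - \<epsilon> (m' + j)) * s n (m' + j) \<omega>) \<cdot>\<^sub>v col H j)
        ({0..D' + D} - {D'})
      + sample_vec D z n m \<omega>)"

definition eucl_norm_vec :: "complex vec \<Rightarrow> real" where
  "eucl_norm_vec v = L2_set (\<lambda>i. cmod (v $ i)) {..<dim_vec v}"

text \<open>\<open>v \<bullet>c v\<close> is \<open>v\<^sup>H v\<close>; the expectations, and hence the ratio, are taken in the complex numbers.\<close>

definition sinr :: "'w measure \<Rightarrow> ('w \<Rightarrow> complex vec) \<Rightarrow> ('w \<Rightarrow> complex vec) \<Rightarrow> complex" where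
  "sinr \<Omega> \<phi> zhat = (\<integral>\<omega>. \<phi> \<omega> \<bullet>c \<phi> \<omega> \<partial>\<Omega>) / (\<integral>\<omega>. zhat \<omega> \<bullet>c zhat \<omega> \<partial>\<Omega>)"

lemma dim_sub_channel [simp]:
  "dim_row (sub_channel D h n m) = D + 1"
  "dim_col (sub_channel D h n m) = min m D + D + 1"
  by (simp_all add: sub_channel_def Let_def)

lemma smult_col_sub_channel_carrier:
  "(\<lambda>j. c j \<cdot>\<^sub>v col (sub_channel D h n m) j) \<in> J \<rightarrow> carrier_vec (D + 1)"
  by (rule Pi_I, rule carrier_vecI, simp only: index_smult_vec(2) dim_col dim_sub_channel)

lemma index_finsum_smult_col:
  assumes "finite J" and "i < D + 1"
  shows "finsum_vec TYPE(complex) (D + 1) (\<lambda>j. c j \<cdot>\<^sub>v col (sub_channel D h n m) j) J $ i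
       = (\<Sum>j\<in>J. c j * col (sub_channel D h n m) j $ i)"
proof -
  have "(c j \<cdot>\<^sub>v col (sub_channel D h n m) j) $ i = c j * col (sub_channel D h n m) j $ i" for j
    by (rule index_smult_vec(1)) (simp only: dim_col dim_sub_channel assms(2))
  then show ?thesis
    using index_finsum_vec[OF assms smult_col_sub_channel_carrier] by simp
qed

lemma dim_finsum_smult_col:
  "dim_vec (finsum_vec TYPE(complex) (D + 1) (\<lambda>j. c j \<cdot>\<^sub>v col (sub_channel D h n m) j) J)
   = D + 1"
  by (rule carrier_vecD[OF finsum_vec_closed[OF smult_col_sub_channel_carrier]])

text \<open>\<^const>\<open>sub_channel\<close> is the matrix of the stacked input-output relation.\<close>

lemma received_vec_eq:
  "sample_vec D (received_sample D h s z) n m \<omega> =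
     finsum_vec TYPE(complex) (D + 1)
       (\<lambda>j. s n (m - D + j) \<omega> \<cdot>\<^sub>v col (sub_channel D h n m) j) {0..min m D + D}
     + sample_vec D z n m \<omega>" (is "?lhs = ?rhs")
proof (rule eq_vecI)
  fix i assume "i < dim_vec ?rhs"
  then have i: "i < D + 1" by (simp add: sample_vec_def)
  define m' D' where "m' = m - D" and "D' = min m D"
  have m: "m' + D' = m" and D': "D' \<le> D" and m': "D' < D \<longrightarrow> m' = 0"
    unfolding m'_def D'_def by simp_all
  define J where "J = {j\<in>{0..D' + D}. j \<le> D' + i \<and> D' + i - j \<le> D}"
  have zi: "sample_vec D f n m \<omega> $ i = f n (m + i) \<omega>"
    and dz: "dim_vec (sample_vec D f n m \<omega>) = D + 1" for f
    using i by (simp_all add: sample_vec_def)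
  have entry: "col (sub_channel D h n m) j $ i
      = (if j \<le> D' + i \<and> D' + i - j \<le> D then h n (m + i) (D' + i - j) else 0)"
    if "j \<le> D' + D" for j
    using i that by (simp add: sub_channel_def Let_def D'_def)
  have "(\<Sum>j = 0..D' + D. s n (m' + j) \<omega> * col (sub_channel D h n m) j $ i)
      = (\<Sum>j = 0..D' + D. if j \<le> D' + i \<and> D' + i - j \<le> D
           then s n (m' + j) \<omega> * h n (m + i) (D' + i - j) else 0)"
    by (rule sum.cong) (simp_all add: entry)
  also have "\<dots> = (\<Sum>j\<in>J. s n (m' + j) \<omega> * h n (m + i) (D' + i - j))"
    unfolding J_def by (rule sum.inter_filter[symmetric]) simp
  also have "\<dots> = (\<Sum>d\<le>min (m + i) D. h n (m + i) d * s n (m + i - d) \<omega>)"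
  proof (rule sum.reindex_bij_witness[of _ "\<lambda>d. D' + i - d" "\<lambda>j. D' + i - j"])
    fix j assume "j \<in> J"
    then have j: "j \<le> D' + i" "D' + i - j \<le> D" "j \<le> D' + D" unfolding J_def by auto
    show "D' + i - (D' + i - j) = j" using j by linarith
    show "D' + i - j \<in> {..min (m + i) D}" using j m by simp
    have "m + i - (D' + i - j) = m' + j" using j m by linarith
    then show "h n (m + i) (D' + i - j) * s n (m + i - (D' + i - j)) \<omega>
        = s n (m' + j) \<omega> * h n (m + i) (D' + i - j)" by simp
  next
    fix d assume "d \<in> {..min (m + i) D}"
    then have d: "d \<le> m + i" "d \<le> D" by simp_all
    have le: "d \<le> D' + i"
    proof (cases "D' < D")
      case True
      then show ?thesis using m m' d by simp
    next
      case False
      then show ?thesis using d D' by simp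
    qed
    then show "D' + i - (D' + i - d) = d" by linarith
    show "D' + i - d \<in> J" unfolding J_def using le d i by auto
  qed
  finally have main: "(\<Sum>j = 0..D' + D. s n (m' + j) \<omega> * col (sub_channel D h n m) j $ i)
      = (\<Sum>d\<le>min (m + i) D. h n (m + i) d * s n (m + i - d) \<omega>)" .
  have "?rhs $ i = (\<Sum>j = 0..D' + D. s n (m' + j) \<omega> * col (sub_channel D h n m) j $ i)
      + z n (m + i) \<omega>"
    using i index_finsum_smult_col[of "{0..min m D + D}" i D _ h n m]
    unfolding m'_def D'_def by (subst index_add_vec(1), simp only: dz) (simp only: zi finite_atLeastAtMost)
  then show "?lhs $ i = ?rhs $ i"
    unfolding main zi received_sample_def by (rule sym)
qed (simp add: sample_vec_def)

text \<open>
  Under perfect cancellation the received vector after interference cancellation is the sum of the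
  signal component and the noise-plus-interference component.
\<close>

lemma cancelled_vec_eq:
  assumes "m + D < M"
    and "\<forall>k<M. \<epsilon> k \<in> {0, 1}"
    and "\<forall>k<M. \<epsilon> k = 1 \<longrightarrow> sbar n k \<omega> = s n k \<omega>"
  shows "cancelled_vec D h \<epsilon> (received_sample D h s z) sbar n m \<omega>
       = signal_component D h s n m \<omega> + noise_interference_component D h \<epsilon> s z n m \<omega>"
    (is "?lhs = ?rhs")
proof -
  let ?D' = "min m D"
  let ?J = "{0..?D' + D} - {?D'}"
  have dim_lhs: "dim_vec ?lhs = D + 1"
    unfolding cancelled_vec_def Let_def index_minus_vec(2)
    by (rule dim_finsum_smult_col)
  have dim_nic: "dim_vec (noise_interference_component D h \<epsilon> s z n m \<omega>) = D + 1"
    unfolding noise_interference_component_def Let_def index_add_vec(2) sample_vec_def by simp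
  then have dim_rhs: "dim_vec ?rhs = D + 1" by simp
  show ?thesis
  proof (rule eq_vecI)
    fix i assume "i < dim_vec ?rhs"
    then have i: "i < D + 1" unfolding dim_rhs .
    define c where "c = (\<lambda>j. col (sub_channel D h n m) j $ i)"
    have fin: "finite ?J" "finite {0..?D' + D}" by simp_all
    have zi: "sample_vec D f n m \<omega> $ i = f n (m + i) \<omega>"
      and dz: "dim_vec (sample_vec D f n m \<omega>) = D + 1" for f
      using i by (simp_all add: sample_vec_def)
    have m: "m - D + ?D' = m" by simp
    have lhs_i: "?lhs $ i = (\<Sum>j = 0..?D' + D. s n (m - D + j) \<omega> * c j) + z n (m + i) \<omega>
        - (\<Sum>j\<in>?J. complex_of_real (\<epsilon> (m - D + j)) * sbar n (m - D + j) \<omega> * c j)"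
      using i index_finsum_smult_col[OF fin(1) i, of _ h n m]
        index_finsum_smult_col[OF fin(2) i, of _ h n m]
      unfolding cancelled_vec_def Let_def received_vec_eq c_def
      by (subst index_minus_vec(1), simp only: dim_finsum_smult_col)
         (subst index_add_vec(1), simp only: dz, simp only: zi)
    have "noise_interference_component D h \<epsilon> s z n m \<omega> $ i
        = (\<Sum>j\<in>?J. complex_of_real (1 - \<epsilon> (m - D + j)) * s n (m - D + j) \<omega> * c j)
          + z n (m + i) \<omega>"
      using i index_finsum_smult_col[OF fin(1) i, of _ h n m]
      unfolding noise_interference_component_def Let_def c_def
      by (subst index_add_vec(1), simp only: dz) (simp only: zi)
    moreover have "signal_component D h s n m \<omega> $ i = s n m \<omega> * c ?D'"
      unfolding signal_component_def c_def using i by (intro index_smult_vec(1)) simp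
    ultimately have rhs_i: "?rhs $ i = s n m \<omega> * c ?D'
        + ((\<Sum>j\<in>?J. complex_of_real (1 - \<epsilon> (m - D + j)) * s n (m - D + j) \<omega> * c j)
          + z n (m + i) \<omega>)"
      using i dim_nic by (subst index_add_vec(1)) simp_all
    have split: "(\<Sum>j = 0..?D' + D. s n (m - D + j) \<omega> * c j)
        = s n m \<omega> * c ?D' + (\<Sum>j\<in>?J. s n (m - D + j) \<omega> * c j)"
      by (subst sum.remove[of _ "?D'"]) (simp_all add: m)
    have "(\<Sum>j\<in>?J. s n (m - D + j) \<omega> * c j)
        - (\<Sum>j\<in>?J. complex_of_real (\<epsilon> (m - D + j)) * sbar n (m - D + j) \<omega> * c j)
        = (\<Sum>j\<in>?J. complex_of_real (1 - \<epsilon> (m - D + j)) * s n (m - D + j) \<omega> * c j)"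
      unfolding sum_subtractf[symmetric]
    proof (rule sum.cong)
      fix j assume "j \<in> ?J"
      then have lt: "m - D + j < M" using assms(1) by auto
      then have "\<epsilon> (m - D + j) = 0
          \<or> \<epsilon> (m - D + j) = 1 \<and> sbar n (m - D + j) \<omega> = s n (m - D + j) \<omega>"
        using assms(2,3) by blast
      then show "s n (m - D + j) \<omega> * c j
        - complex_of_real (\<epsilon> (m - D + j)) * sbar n (m - D + j) \<omega> * c j
        = complex_of_real (1 - \<epsilon> (m - D + j)) * s n (m - D + j) \<omega> * c j"
        by (elim disjE conjE) simp_all
    qed simp
    with split show "?lhs $ i = ?rhs $ i"
      unfolding lhs_i rhs_i by (simp only: algebra_simps)
  qed (simp only: dim_lhs dim_rhs)
qed

end

theory Submission
  imports Defs
begin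

text \<open>
  Every entry of the residual vector is a linear combination of the samples \<open>s\<^sub>n\<^sub>,\<^sub>k\<close> plus one
  noise sample. Samples with different symbol indices are built from disjoint sets of the
  independent, centred data symbols, hence are orthogonal in \<open>L\<^sup>2\<close>, and all of them are orthogonal
  to the noise. So Pythagoras removes every cross term; summing the powers of the entries and
  interchanging the two sums produces the column norms. The weights satisfy
  \<open>(1 - \<epsilon>)\<^sup>2 = 1 - \<epsilon>\<close> because \<open>\<epsilon> \<in> {0, 1}\<close>.
\<close>

section \<open>Square-integrable complex random variables\<close>

definition L2_rv :: "'w measure \<Rightarrow> ('w \<Rightarrow> complex) \<Rightarrow> bool" where
  "L2_rv M f \<longleftrightarrow> f \<in> borel_measurable M \<and> integrable M (\<lambda>\<omega>. (cmod (f \<omega>))\<^sup>2)"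

lemma borel_measurable_cnj: "cnj \<in> borel_measurable borel"
  by (intro borel_measurable_continuous_onI continuous_intros)

text \<open>The sum of the two squares dominates the product. Measurability is a separate clause of
  \<open>L2_rv\<close> because integrability of the squared modulus does not make \<open>f\<close>
  itself measurable.\<close>

lemma integrable_mult_cnj_L2_rv:
  assumes "L2_rv M f" and "L2_rv M g"
  shows "integrable M (\<lambda>\<omega>. f \<omega> * cnj (g \<omega>))"
proof (rule Bochner_Integration.integrable_bound)
  show "integrable M (\<lambda>\<omega>. (cmod (f \<omega>))\<^sup>2 + (cmod (g \<omega>))\<^sup>2)"
    using assms by (simp add: L2_rv_def)
  show "(\<lambda>\<omega>. f \<omega> * cnj (g \<omega>)) \<in> borel_measurable M"
    using assms unfolding L2_rv_def
    by (intro borel_measurable_times measurable_compose[OF _ borel_measurable_cnj]) simp_all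
  \<comment> \<open>The sharp constant 1/2 is dropped, as only an integrable majorant is
    wanted.\<close>
  have "x * y \<le> x\<^sup>2 + y\<^sup>2" if "0 \<le> x" "0 \<le> y" for x y :: real
  proof -
    have "2 * (x * y) \<le> x\<^sup>2 + y\<^sup>2"
      using sum_squares_bound[of x y] by (simp add: mult.assoc)
    moreover have "0 \<le> x * y" using that by simp
    ultimately show ?thesis by linarith
  qed
  then show "AE \<omega> in M. cmod (f \<omega> * cnj (g \<omega>)) \<le> norm ((cmod (f \<omega>))\<^sup>2 + (cmod (g \<omega>))\<^sup>2)"
    by (simp add: norm_mult)
qed

lemma L2_rv_cmult:
  assumes "L2_rv M f"
  shows "L2_rv M (\<lambda>\<omega>. c * f \<omega>)"
  using assms by (auto simp: L2_rv_def norm_mult power_mult_distrib intro: borel_measurable_times)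

text \<open>Puts the cross term in the form \<open>x * cnj y\<close>, the integrand of the
  orthogonality assumptions. Closure under sums and Pythagoras both rest on it.\<close>

lemma cmod_add_square:
  "(cmod (x + y))\<^sup>2 = (cmod x)\<^sup>2 + (cmod y)\<^sup>2 + 2 * Re (x * cnj y)"
  unfolding cmod_power2 by (simp add: power2_eq_square algebra_simps)

lemma L2_rv_add:
  assumes "L2_rv M f" and "L2_rv M g"
  shows "L2_rv M (\<lambda>\<omega>. f \<omega> + g \<omega>)"
  unfolding L2_rv_def cmod_add_square
  using assms integrable_Re[OF integrable_mult_cnj_L2_rv[OF assms]]
  by (intro conjI borel_measurable_add Bochner_Integration.integrable_add integrable_mult_right)
    (simp_all only: L2_rv_def)

lemma L2_rv_sum:
  assumes "\<And>j. j \<in> J \<Longrightarrow> L2_rv M (f j)"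
  shows "L2_rv M (\<lambda>\<omega>. \<Sum>j\<in>J. f j \<omega>)"
  using assms
\<comment> \<open>An infinite \<open>J\<close> makes the sum 0 by convention, so that case is the
  zero function, just like the empty one.\<close>
proof (induction J rule: infinite_finite_induct)
  case (insert j J)
  then show ?case by (simp add: L2_rv_add)
qed (simp_all add: L2_rv_def)

text \<open>Pythagoras: \<open>Re\<close> commutes with the integral, so orthogonality kills the
  cross term of \<open>cmod_add_square\<close>.\<close>

lemma expectation_cmod_add_square:
  assumes f: "L2_rv M f" and g: "L2_rv M g"
    and orth: "(\<integral>\<omega>. f \<omega> * cnj (g \<omega>) \<partial>M) = 0"
  shows "(\<integral>\<omega>. (cmod (f \<omega> + g \<omega>))\<^sup>2 \<partial>M)
       = (\<integral>\<omega>. (cmod (f \<omega>))\<^sup>2 \<partial>M) + (\<integral>\<omega>. (cmod (g \<omega>))\<^sup>2 \<partial>M)"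
proof -
  note fg = integrable_mult_cnj_L2_rv[OF f g]
  have "(\<integral>\<omega>. Re (f \<omega> * cnj (g \<omega>)) \<partial>M) = 0"
    using integral_Re[OF fg] orth by simp
  then show ?thesis
    using f g integrable_Re[OF fg] unfolding L2_rv_def cmod_add_square
    \<comment> \<open>Leaves \<open>Re (f \<omega> * cnj (g \<omega>))\<close> unexpanded, the shape
      in which its vanishing integral is known.\<close>
    by (simp del: times_complex.sel)
qed

text \<open>Linearity in the left slot. Sums in the right slot are reached from it by conjugating
  the integral.\<close>

lemma expectation_sum_mult_cnj:
  assumes "\<And>j. j \<in> J \<Longrightarrow> L2_rv M (f j)" and "L2_rv M g"
    and "\<And>j. j \<in> J \<Longrightarrow> (\<integral>\<omega>. f j \<omega> * cnj (g \<omega>) \<partial>M) = 0"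
  shows "(\<integral>\<omega>. (\<Sum>j\<in>J. c j * f j \<omega>) * cnj (g \<omega>) \<partial>M) = 0"
proof -
  have "(\<integral>\<omega>. (\<Sum>j\<in>J. c j * f j \<omega>) * cnj (g \<omega>) \<partial>M)
      = (\<integral>\<omega>. (\<Sum>j\<in>J. c j * (f j \<omega> * cnj (g \<omega>))) \<partial>M)"
    by (simp add: sum_distrib_right mult.assoc)
  also have "\<dots> = (\<Sum>j\<in>J. c j * (\<integral>\<omega>. f j \<omega> * cnj (g \<omega>) \<partial>M))"
    using assms(1,2)
    by (subst Bochner_Integration.integral_sum)
      (auto intro!: Bochner_Integration.integrable_mult_right integrable_mult_cnj_L2_rv)
  finally show ?thesis using assms(3) by simp
qed

text \<open>Each new term is orthogonal to the sum already collected, so the two-term Pythagoras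
  applies at every step of the induction.\<close>

lemma expectation_cmod_sum_square:
  assumes "finite J" and "\<And>j. j \<in> J \<Longrightarrow> L2_rv M (f j)"
    and "\<And>i j. i \<in> J \<Longrightarrow> j \<in> J \<Longrightarrow> i \<noteq> j \<Longrightarrow> (\<integral>\<omega>. f i \<omega> * cnj (f j \<omega>) \<partial>M) = 0"
  shows "(\<integral>\<omega>. (cmod (\<Sum>j\<in>J. c j * f j \<omega>))\<^sup>2 \<partial>M)
       = (\<Sum>j\<in>J. (cmod (c j))\<^sup>2 * (\<integral>\<omega>. (cmod (f j \<omega>))\<^sup>2 \<partial>M))"
  using assms
proof (induction J rule: finite_induct)
  case empty
  then show ?case by simp
next
  case (insert k J)
  have "(\<integral>\<omega>. (\<Sum>j\<in>J. c j * f j \<omega>) * cnj (f k \<omega>) \<partial>M) = 0"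
    by (rule expectation_sum_mult_cnj) (use insert in auto)
  \<comment> \<open>The scalar leaves the conjugated slot as \<open>cnj (c k)\<close> and multiplies
    a vanishing integral.\<close>
  then have "(\<integral>\<omega>. (\<Sum>j\<in>J. c j * f j \<omega>) * cnj (c k * f k \<omega>) \<partial>M) = 0"
    by (simp add: mult.left_commute[of _ "cnj (c k)"])
  from expectation_cmod_add_square[OF L2_rv_sum L2_rv_cmult this]
  have "(\<integral>\<omega>. (cmod ((\<Sum>j\<in>J. c j * f j \<omega>) + c k * f k \<omega>))\<^sup>2 \<partial>M)
      = (\<integral>\<omega>. (cmod (\<Sum>j\<in>J. c j * f j \<omega>))\<^sup>2 \<partial>M) + (\<integral>\<omega>. (cmod (c k * f k \<omega>))\<^sup>2 \<partial>M)"
    using insert by (simp add: L2_rv_cmult)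
  then show ?case
    using insert by (simp add: add.commute norm_mult power_mult_distrib)
qed

text \<open>Conjugation is Borel measurable, so conjugating one of two independent variables
  preserves independence and the expectation still factors.\<close>

lemma (in prob_space) indep_vars_expectation_mult_cnj:
  fixes Y :: "'i \<Rightarrow> 'a \<Rightarrow> complex"
  assumes indep: "indep_vars (\<lambda>_. borel) Y I"
    and I: "i \<in> I" "j \<in> I" "i \<noteq> j"
    and int: "integrable M (Y i)" "integrable M (Y j)"
  shows "(\<integral>\<omega>. Y i \<omega> * cnj (Y j \<omega>) \<partial>M) = (\<integral>\<omega>. Y i \<omega> \<partial>M) * cnj (\<integral>\<omega>. Y j \<omega> \<partial>M)"
proof -
  \<comment> \<open>The product rule for expectations concerns an indexed family; conjugating only
    member \<open>j\<close> turns the product over \<open>{i, j}\<close> into the wanted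
    integrand.\<close>
  define Z where "Z = (\<lambda>k \<omega>. if k = j then cnj (Y k \<omega>) else Y k \<omega>)"
  have "indep_vars (\<lambda>_. borel) (\<lambda>k \<omega>. (if k = j then cnj else id) (Y k \<omega>)) {i, j}"
    by (rule indep_vars_compose2[OF indep_vars_subset[OF indep]]) (use I borel_measurable_cnj in auto)
  moreover have "(\<lambda>k \<omega>. (if k = j then cnj else id) (Y k \<omega>)) = Z"
    by (auto simp: Z_def fun_eq_iff)
  ultimately have "indep_vars (\<lambda>_. borel) Z {i, j}" by simp
  moreover have "integrable M (Z k)" if "k \<in> {i, j}" for k
    using that int I(3) by (auto simp: Z_def)
  ultimately have "(\<integral>\<omega>. (\<Prod>k\<in>{i, j}. Z k \<omega>) \<partial>M) = (\<Prod>k\<in>{i, j}. \<integral>\<omega>. Z k \<omega> \<partial>M)"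
    by (intro indep_vars_lebesgue_integral) auto
  then show ?thesis using I(3) by (simp add: Z_def)
qed

section \<open>Second moments of the transmitted samples\<close>

context prob_space
begin

context
  fixes X :: "nat \<Rightarrow> nat \<Rightarrow> 'a \<Rightarrow> complex" and K N :: nat
  assumes X_indep: "indep_vars (\<lambda>_. borel) (\<lambda>(i, k). X i k) ({..<K} \<times> {..<N})"
    and X_sq_integrable: "\<forall>i<K. \<forall>k<N. integrable M (\<lambda>\<omega>. (cmod (X i k \<omega>))\<^sup>2)"
begin

text \<open>Measurability is extracted from independence, which includes it for each member of the
  family.\<close>

lemma L2_rv_symbol:
  assumes "i < K" and "k < N"
  shows "L2_rv M (X i k)"
  using X_indep X_sq_integrable assms unfolding indep_vars_def2 L2_rv_def by fastforce

lemma L2_rv_time_sample: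
  assumes "i < K"
  shows "L2_rv M (time_sample N X n i)"
  unfolding time_sample_def
  by (intro L2_rv_cmult L2_rv_sum)
    (auto intro: L2_rv_cmult L2_rv_symbol[OF assms] simp: mult.commute[of "X _ _ _"])

lemma time_sample_uncorrelated:
  assumes X_mean: "\<forall>i<K. \<forall>k<N. (\<integral>\<omega>. X i k \<omega> \<partial>M) = 0"
    and i: "i < K" "i' < K" "i \<noteq> i'"
  shows "(\<integral>\<omega>. time_sample N X n i \<omega> * cnj (time_sample N X n i' \<omega>) \<partial>M) = 0"
proof -
  \<comment> \<open>Normalisation and Fourier phase merge into one deterministic weight.\<close>
  define e where "e = (\<lambda>k. 1 / complex_of_real (sqrt (real N))
    * exp (\<i> * complex_of_real (2 * pi * real k * real n / real N)))"
  have ts: "time_sample N X n i \<omega> = (\<Sum>k<N. e k * X i k \<omega>)" for i \<omega>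
    by (simp add: time_sample_def e_def sum_distrib_left mult_ac)
  \<comment> \<open>The constant 1 is square-integrable on a probability space, so square
    integrability implies integrability.\<close>
  have int: "integrable M (X i k)" if "i < K" "k < N" for i k
    using L2_rv_symbol[OF that] integrable_mult_cnj_L2_rv[of M "X i k" "\<lambda>_. 1"]
    by (simp add: L2_rv_def)
  \<comment> \<open>Since \<open>i \<noteq> i'\<close>, the index pairs differ even when
    \<open>k = k'\<close>, so independence and zero means apply.\<close>
  have XX: "(\<integral>\<omega>. X i k \<omega> * cnj (X i' k' \<omega>) \<partial>M) = 0" if "k < N" "k' < N" for k k'
    using indep_vars_expectation_mult_cnj[OF X_indep, of "(i, k)" "(i', k')"] that i X_mean int
    by simp
  \<comment> \<open>The double sum is expanded one slot at a time: first the sample of index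
    \<open>i\<close>, then, after conjugation swaps the slots, the one of index
    \<open>i'\<close>.\<close>
  have tX: "(\<integral>\<omega>. time_sample N X n i \<omega> * cnj (X i' k' \<omega>) \<partial>M) = 0" if "k' < N" for k'
    unfolding ts by (rule expectation_sum_mult_cnj) (use that i XX L2_rv_symbol in auto)
  have "(\<integral>\<omega>. X i' k' \<omega> * cnj (time_sample N X n i \<omega>) \<partial>M) = 0" if "k' < N" for k'
    using arg_cong[OF tX[OF that], of cnj]
    by (subst (asm) Bochner_Integration.integral_cnj[symmetric]) (simp add: mult.commute)
  then have "(\<integral>\<omega>. time_sample N X n i' \<omega> * cnj (time_sample N X n i \<omega>) \<partial>M) = 0"
    by (subst (1) ts, intro expectation_sum_mult_cnj) (use i L2_rv_symbol L2_rv_time_sample in auto)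
  from arg_cong[OF this, of cnj] show ?thesis
    by (subst (asm) Bochner_Integration.integral_cnj[symmetric]) (simp add: mult.commute)
qed

end

end

section \<open>The SINR as a ratio of real expectations\<close>

lemma eucl_norm_vec_square: "(eucl_norm_vec v)\<^sup>2 = (\<Sum>i<dim_vec v. (cmod (v $ i))\<^sup>2)"
  by (simp add: eucl_norm_vec_def L2_set_def sum_nonneg)

lemma cscalar_prod_self: "v \<bullet>c v = complex_of_real ((eucl_norm_vec v)\<^sup>2)"
  unfolding eucl_norm_vec_square scalar_prod_def
  by (simp add: atLeast0LessThan complex_norm_square del: of_real_power)

lemma sinr_eq:
  "sinr \<Omega> \<phi> zhat = complex_of_real
     ((\<integral>\<omega>. (eucl_norm_vec (\<phi> \<omega>))\<^sup>2 \<partial>\<Omega>) / (\<integral>\<omega>. (eucl_norm_vec (zhat \<omega>))\<^sup>2 \<partial>\<Omega>))"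
  unfolding sinr_def cscalar_prod_self integral_complex_of_real by simp

theorem theorem1:
  fixes \<Omega> :: "'w measure"
    and M N D P n m m' D' :: nat
    and X s z r sbar :: "nat \<Rightarrow> nat \<Rightarrow> 'w \<Rightarrow> complex"
    and h :: "nat \<Rightarrow> nat \<Rightarrow> nat \<Rightarrow> complex"
    and \<rho> :: "nat \<Rightarrow> complex" and l \<kappa> :: "nat \<Rightarrow> real"
    and a g :: "real \<Rightarrow> complex"
    and Ts Pt \<sigma>\<^sub>w :: real
    and \<epsilon> :: "nat \<Rightarrow> real"
    and \<phi> zhat :: "'w \<Rightarrow> complex vec"
    and H :: "complex mat"
  assumes prob: "prob_space \<Omega>"
    and dims: "1 \<le> M" "1 \<le> N" "D < M"
    and X_indep: "prob_space.indep_vars \<Omega> (\<lambda>_. borel) (\<lambda>(i, k). X i k) ({..<M} \<times> {..<N})"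
    and X_sq_integrable: "\<forall>i<M. \<forall>k<N. integrable \<Omega> (\<lambda>\<omega>. (cmod (X i k \<omega>))\<^sup>2)"
    and X_mean: "\<forall>i<M. \<forall>k<N. (\<integral>\<omega>. X i k \<omega> \<partial>\<Omega>) = 0"
    and s_eq: "s = time_sample N X"
    and power: "\<forall>b<N. \<forall>i<M. (\<integral>\<omega>. (cmod (s b i \<omega>))\<^sup>2 \<partial>\<Omega>) = Pt"
    and z_measurable: "\<forall>b<N. \<forall>i<M. z b i \<in> borel_measurable \<Omega>"
    and z_sq_integrable: "\<forall>b<N. \<forall>i<M. integrable \<Omega> (\<lambda>\<omega>. (cmod (z b i \<omega>))\<^sup>2)"
    and z_mean: "\<forall>b<N. \<forall>i<M. (\<integral>\<omega>. z b i \<omega> \<partial>\<Omega>) = 0"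
    and z_variance: "\<forall>b<N. \<forall>i<M. (\<integral>\<omega>. (cmod (z b i \<omega>))\<^sup>2 \<partial>\<Omega>) = \<sigma>\<^sub>w\<^sup>2"
    and noise_pos: "\<sigma>\<^sub>w\<^sup>2 > 0"
    and uncorrelated: "\<forall>b<N. \<forall>i<M. \<forall>k<M. (\<integral>\<omega>. s b i \<omega> * cnj (z b k \<omega>) \<partial>\<Omega>) = 0"
    and Ts_pos: "Ts > 0"
    and g_eq: "g = matched_pulse a"
    and h_eq: "\<forall>b<N. \<forall>i<M. \<forall>d\<le>D. h b i d = channel_coeff M N P \<rho> l \<kappa> g Ts b i d"
    and r_eq: "\<forall>b<N. \<forall>i<M. \<forall>\<omega>\<in>space \<Omega>. r b i \<omega> = received_sample D h s z b i \<omega>"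
    and eps: "\<forall>k<M. \<epsilon> k \<in> {0, 1}"
    and perfect: "\<forall>b<N. \<forall>k<M. \<epsilon> k = 1 \<longrightarrow> (\<forall>\<omega>\<in>space \<Omega>. sbar b k \<omega> = s b k \<omega>)"
    and idx: "n < N" "m \<le> M - D - 1"
    and m'_eq: "m' = m - D" and D'_eq: "D' = min m D"
    and H_eq: "H = sub_channel D h n m"
    and phi_eq: "\<phi> = signal_component D h s n m"
    and zhat_eq: "zhat = noise_interference_component D h \<epsilon> s z n m"
  shows "sinr \<Omega> \<phi> zhat =
    complex_of_real
      (Pt * (eucl_norm_vec (col H D'))\<^sup>2
       / ((\<Sum>j\<in>{0..D' + D} - {D'}. (1 - \<epsilon> (m' + j)) * Pt * (eucl_norm_vec (col H j))\<^sup>2)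
          + (real D + 1) * \<sigma>\<^sub>w\<^sup>2))"
proof -
  interpret prob_space \<Omega> by (rule prob)
  define J where "J = {0..D' + D} - {D'}"
  \<comment> \<open>Cancellation factor and channel entry together, so that row \<open>i\<close> of
    the residual is a plain linear combination of samples.\<close>
  define c where "c = (\<lambda>i j. complex_of_real (1 - \<epsilon> (m' + j)) * col H j $ i)"
  have J_fin: "finite J" by (simp add: J_def)
  \<comment> \<open>\<open>D < M\<close> makes the truncated \<open>M - D - 1\<close> a true
    difference. The bound covers every row index \<open>m + i\<close> and, through
    \<open>m' + D' = m\<close>, every sample index \<open>m' + j\<close>.\<close>
  have mD: "m + D < M" using idx dims by linarith
  then have m: "m < M" by simp
  have jM: "m' + j < M" if "j \<in> J" for j
    using that mD unfolding J_def m'_eq D'_eq by auto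
  have s_L2: "L2_rv \<Omega> (s n i)" if "i < M" for i
    unfolding s_eq by (rule L2_rv_time_sample[OF X_indep X_sq_integrable that])
  have z_L2: "L2_rv \<Omega> (z n i)" if "i < M" for i
    using z_measurable z_sq_integrable idx(1) that by (simp add: L2_rv_def)
  have s_orth: "(\<integral>\<omega>. s n i \<omega> * cnj (s n k \<omega>) \<partial>\<Omega>) = 0" if "i < M" "k < M" "i \<noteq> k" for i k
    unfolding s_eq
    by (rule time_sample_uncorrelated[OF X_indep X_sq_integrable X_mean that])
  have dim_H: "dim_vec (col H j) = D + 1" for j
    unfolding H_eq by simp

  have signal: "(\<integral>\<omega>. (eucl_norm_vec (\<phi> \<omega>))\<^sup>2 \<partial>\<Omega>) = Pt * (eucl_norm_vec (col H D'))\<^sup>2"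
  proof -
    have "(eucl_norm_vec (\<phi> \<omega>))\<^sup>2 = (cmod (s n m \<omega>))\<^sup>2 * (eucl_norm_vec (col H D'))\<^sup>2" for \<omega>
      unfolding phi_eq signal_component_def H_eq[symmetric] D'_eq[symmetric] eucl_norm_vec_square
      by (simp add: norm_mult power_mult_distrib sum_distrib_left)
    then show ?thesis using power idx(1) m by simp
  qed

  have entry: "zhat \<omega> $ i = (\<Sum>j\<in>J. c i j * s n (m' + j) \<omega>) + z n (m + i) \<omega>"
    if "i < D + 1" for i \<omega>
  proof -
    have "zhat \<omega> $ i = finsum_vec TYPE(complex) (D + 1)
        (\<lambda>j. (complex_of_real (1 - \<epsilon> (m' + j)) * s n (m' + j) \<omega>) \<cdot>\<^sub>v col H j) J $ i
        + sample_vec D z n m \<omega> $ i"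
      unfolding zhat_eq noise_interference_component_def Let_def H_eq J_def m'_eq D'_eq
      using that by (intro index_add_vec(1)) (simp add: sample_vec_def)
    also have "\<dots> = (\<Sum>j\<in>J. complex_of_real (1 - \<epsilon> (m' + j)) * s n (m' + j) \<omega> * col H j $ i)
        + z n (m + i) \<omega>"
      unfolding H_eq using that
      by (simp only: index_finsum_smult_col[OF J_fin that]) (simp add: sample_vec_def)
    finally show ?thesis by (simp add: c_def mult_ac)
  qed
  have dim_zhat: "dim_vec (zhat \<omega>) = D + 1" for \<omega>
    unfolding zhat_eq noise_interference_component_def Let_def by (simp add: sample_vec_def)
  have c_sq: "(cmod (c i j))\<^sup>2 = (1 - \<epsilon> (m' + j)) * (cmod (col H j $ i))\<^sup>2" if "j \<in> J" for i j
  proof -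
    have "\<epsilon> (m' + j) \<in> {0, 1}" using eps jM[OF that] by blast
    then show ?thesis by (auto simp: c_def)
  qed

  have entry_L2: "L2_rv \<Omega> (\<lambda>\<omega>. \<Sum>j\<in>J. c i j * s n (m' + j) \<omega>)" for i
    by (intro L2_rv_sum L2_rv_cmult s_L2 jM)
  have zhat_L2: "L2_rv \<Omega> (\<lambda>\<omega>. zhat \<omega> $ i)" if "i < D + 1" for i
    unfolding entry[OF that] using that mD by (intro L2_rv_add entry_L2 z_L2) simp
  \<comment> \<open>The squared norm adds the powers of single entries, so only correlations within
    one row matter. Pythagoras first splits off the noise, then separates the samples.\<close>
  have entry_power: "(\<integral>\<omega>. (cmod (zhat \<omega> $ i))\<^sup>2 \<partial>\<Omega>)
      = (\<Sum>j\<in>J. (1 - \<epsilon> (m' + j)) * Pt * (cmod (col H j $ i))\<^sup>2) + \<sigma>\<^sub>w\<^sup>2"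
    if i: "i < D + 1" for i
  proof -
    have miM: "m + i < M" using i mD by simp
    have "(\<integral>\<omega>. (\<Sum>j\<in>J. c i j * s n (m' + j) \<omega>) * cnj (z n (m + i) \<omega>) \<partial>\<Omega>) = 0"
      by (rule expectation_sum_mult_cnj)
        (use s_L2 z_L2 jM miM uncorrelated idx(1) in auto)
    then have "(\<integral>\<omega>. (cmod (zhat \<omega> $ i))\<^sup>2 \<partial>\<Omega>)
        = (\<integral>\<omega>. (cmod (\<Sum>j\<in>J. c i j * s n (m' + j) \<omega>))\<^sup>2 \<partial>\<Omega>)
          + (\<integral>\<omega>. (cmod (z n (m + i) \<omega>))\<^sup>2 \<partial>\<Omega>)"
      unfolding entry[OF i] by (rule expectation_cmod_add_square[OF entry_L2 z_L2[OF miM]])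
    also have "(\<integral>\<omega>. (cmod (\<Sum>j\<in>J. c i j * s n (m' + j) \<omega>))\<^sup>2 \<partial>\<Omega>)
        = (\<Sum>j\<in>J. (cmod (c i j))\<^sup>2 * (\<integral>\<omega>. (cmod (s n (m' + j) \<omega>))\<^sup>2 \<partial>\<Omega>))"
      \<comment> \<open>Distinct columns \<open>j\<close> carry distinct symbol indices
        \<open>m' + j\<close>, which is what \<open>s_orth\<close> requires.\<close>
      by (rule expectation_cmod_sum_square) (use J_fin s_L2 s_orth jM in auto)
    also have "\<dots> = (\<Sum>j\<in>J. (1 - \<epsilon> (m' + j)) * Pt * (cmod (col H j $ i))\<^sup>2)"
      by (rule sum.cong) (use power idx(1) jM c_sq in auto)
    finally show ?thesis using z_variance idx(1) miM by simp
  qed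

  have "(\<integral>\<omega>. (eucl_norm_vec (zhat \<omega>))\<^sup>2 \<partial>\<Omega>)
      = (\<Sum>i<D + 1. \<integral>\<omega>. (cmod (zhat \<omega> $ i))\<^sup>2 \<partial>\<Omega>)"
    unfolding eucl_norm_vec_square dim_zhat
    by (rule Bochner_Integration.integral_sum) (use zhat_L2 in \<open>simp add: L2_rv_def\<close>)
  also have "\<dots> = (\<Sum>i<D + 1. (\<Sum>j\<in>J. (1 - \<epsilon> (m' + j)) * Pt * (cmod (col H j $ i))\<^sup>2) + \<sigma>\<^sub>w\<^sup>2)"
    by (rule sum.cong) (simp_all add: entry_power)
  \<comment> \<open>Each of the \<open>D + 1\<close> rows contributes one noise variance.\<close>
  also have "\<dots> = (\<Sum>i<D + 1. \<Sum>j\<in>J. (1 - \<epsilon> (m' + j)) * Pt * (cmod (col H j $ i))\<^sup>2)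
      + (real D + 1) * \<sigma>\<^sub>w\<^sup>2"
    by (simp only: sum.distrib) simp
  \<comment> \<open>With the column fixed, the sum over rows is its squared norm.\<close>
  also have "(\<Sum>i<D + 1. \<Sum>j\<in>J. (1 - \<epsilon> (m' + j)) * Pt * (cmod (col H j $ i))\<^sup>2)
      = (\<Sum>j\<in>J. (1 - \<epsilon> (m' + j)) * Pt * (eucl_norm_vec (col H j))\<^sup>2)"
    unfolding eucl_norm_vec_square dim_H sum_distrib_left by (rule sum.swap)
  finally show ?thesis unfolding sinr_eq signal J_def by simp
qed

end
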